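(* Let $\varphi=(\varphi_n)_{n\in\mathbb N}\in\mathcal S(M)$ be a skeleton in $M$, let $\theta_{s,t}(x)=\Theta(s,x,\varphi)(t)$ ($s\le t$, $x\in M$), let $F\subset\mathbb R\times M$ be a closed set containing the set $B(\varphi)$ of bifurcation points of $\varphi$, and let $\sigma^s_x(k),z^s_x(k),k^s_x$ and $\psi_{s,t}(x)$ be defined from $\theta$ and $F$ as in the context. Suppose that for any $(s,x)\in\mathbb R\times M$: (a) $k^s_x<\infty$; (b) if $k^s_x=0$, then for any $t>s$ there is $n\in I^t$ such that $\theta_{s,\cdot}(x)[t,\infty)=\varphi_n[t,\infty)$. Then $\psi$ is a family of continuous mappings that satisfies the strong flow property and preserves the skeleton $\varphi$, i.e. (i) for all $(s,x)\in\mathbb R\times M$, $\psi_{s,\cdot}(x)\in C([s,\infty):M)$ and $\psi_{s,s}(x)=x$; (ii) for all $s\le t$ and $n\in I^s$, $\psi_{s,t}(\varphi_n(s))=\varphi_n(t)$; (iii) for all $s\le t\le u$, $\psi_{t,u}\circ\psi_{s,t}=\psi_{s,u}$.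
   Context: $(M,\rho)$ is a locally compact separable metric space, with $\rho$ complete and all bounded sets relatively compact. Path space. $X=\bigcup_{s\in\mathbb R}C([s,\infty):M)$; for $f\in C([s,\infty):M)$ write $i(f)=s$ and $e(f)(t)=f(s\vee t)$, $t\in\mathbb R$. $X$ carries the complete separable metric $d(f,g)=|i(f)-i(g)|+\delta(e(f),e(g))$, where $\delta$ is a metric for uniform convergence on compacts on $C(\mathbb R:M)$. For an interval $I$, $fI$ denotes the restriction of $e(f)$ to $I$ (e.g. $f[t,\infty)$). Skeletons. For $\varphi=(\varphi_n)\in X^{\mathbb N}$ put $s_n=i(\varphi_n)$, $x_n=\varphi_n(s_n)$, $I^s=\{n: s_n\le s\}$. $\varphi$ is a skeleton ($\varphi\in\mathcal S(M)$) if: (1) whenever $m,n\in I^s$ and $\varphi_m(s)=\varphi_n(s)$, then $\varphi_m(t)=\varphi_n(t)$ for all $t\ge s$; (2) $\{(s_n,x_n):n\in\mathbb N\}$ is dense in $\mathbb R\times M$; (3) for every compact $L\subset\mathbb R\times M$ the set $\{\varphi_n[s,\infty): n\in I^s,(s,\varphi_n(s))\in L\}$ is relatively compact in $X$. The mapping $\Theta$. Fix a measurable $\ell:X^{\mathbb N}\to X$ such that for each relatively compact sequence $(f_n)$ in $X$, $\ell((f_n))$ is a limit point of $(f_n)$. Fix measurable functions $\varepsilon_k:M\to(0,\infty)$, $k\in\mathbb N$, such that for each $x$ the sequence $(\varepsilon_k(x))_k$ is non-increasing with limit $0$. Put $n^{s,x}_k=\inf\{n\in I^s:\rho(\varphi_n(s),x)<\varepsilon_k(x)\}$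 (always finite), $\varphi^{s,x}_k=\varphi_{n^{s,x}_k}[s,\infty)$ and $\Theta(s,x,\varphi)=\ell((\varphi^{s,x}_k)_{k})$. (It is known that $\theta_{s,\cdot}(x):=\Theta(s,x,\varphi)\in C([s,\infty):M)$, $\theta_{s,s}(x)=x$, and $\theta_{s,t}(\varphi_n(s))=\varphi_n(t)$ for $n\in I^s$, $t\ge s$.) Bifurcation points. For $s<t$, $x\in M$, $\varepsilon>0$ let $\mathcal K^{s,t}_{\varepsilon,x}$ be the closure in $C([s,t]:M)$ of $\{\varphi_n[s,t]: n\in I^s,\varphi_n(s)\in B(x,\varepsilon)\}$, $\mathcal K^{s,t}_x=\bigcap_{\varepsilon>0}\mathcal K^{s,t}_{\varepsilon,x}$, $\nu^{s,t}_x=\#\mathcal K^{s,t}_x\in\mathbb N\cup\{\infty\}$, $\tau^s_x=\inf\{t>s:\nu^{s,t}_x\ge2\}$, and $B(\varphi)=\{(s,x):\tau^s_x=s\}$. Construction of $\psi$. Given the closed set $F\supset B(\varphi)$, set $\sigma^s_x(0)=s$, $z^s_x(0)=x$; if $\sigma^s_x(k)<\infty$, $\sigma^s_x(k+1)=\inf\{t>\sigma^s_x(k):(t,\theta_{\sigma^s_x(k),t}(z^s_x(k)))\in F\}$, and $\sigma^s_x(k+1)=\infty$ if $\sigma^s_x(k)=\infty$; $z^s_x(k+1)=\theta_{\sigma^s_x(k),\sigma^s_x(k+1)}(z^s_x(k))$ if $\sigma^s_x(k+1)<\infty$, and $z^s_x(k+1)=x$ otherwise ($\inf\emptyset=\infty$).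 Put $k^s_x=\inf\{k\ge0:\sigma^s_x(k)=\sigma^s_x(k+1)\}$ and $\sigma^s_x(\infty)=\lim_k\sigma^s_x(k)$. For $t\ge s$: if $t<\sigma^s_x(\infty)$, let $k<k^s_x$ be such that $t\in[\sigma^s_x(k),\sigma^s_x(k+1))$ and put $\psi_{s,t}(x)=\theta_{\sigma^s_x(k),t}(z^s_x(k))$; if $t\ge\sigma^s_x(\infty)$ and $k^s_x<\infty$, put $\psi_{s,t}(x)=\theta_{\sigma^s_x(k^s_x),t}(z^s_x(k^s_x))$; if $t\ge\sigma^s_x(\infty)$ and $k^s_x=\infty$, put $\psi_{s,t}(x)=x$. *)

theory Defs
  imports "HOL-Analysis.Analysis"
begin

section \<open>Path space\<close>

text \<open>
  An element \<open>f\<close> of \<open>C([s,\<infinity>) : M)\<close> is represented by the pair \<open>(i(f), e(f))\<close>, that is, by its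
  initial time \<open>s\<close> and its extension to the whole line that is constant on \<open>(-\<infinity>, s]\<close>.  This
  representation is one-to-one, and every value \<open>f(t)\<close> with \<open>t \<ge> s\<close> is \<open>e(f)(t)\<close>.
\<close>

typedef (overloaded) 'a cpath =
  "{(s :: real, g :: real \<Rightarrow> 'a :: metric_space).
      continuous_on UNIV g \<and> (\<forall>t\<le>s. g t = g s)}"
  by (rule exI[of _ "(0, \<lambda>_. undefined)"]) auto

definition start :: "'a :: metric_space cpath \<Rightarrow> real"
  where "start f = fst (Rep_cpath f)"

definition ext :: "'a :: metric_space cpath \<Rightarrow> real \<Rightarrow> 'a"
  where "ext f = snd (Rep_cpath f)"

text \<open>\<open>tail f s\<close> is the restriction of \<open>e(f)\<close> to \<open>[s,\<infinity>)\<close>, as an element of the path space.\<close>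

definition tail :: "'a :: metric_space cpath \<Rightarrow> real \<Rightarrow> 'a cpath"
  where "tail f s = Abs_cpath (s, \<lambda>t. ext f (max s t))"

lemma cpath_props: "continuous_on UNIV (ext f) \<and> (\<forall>t\<le>start f. ext f t = ext f (start f))"
  using CollectD[OF Rep_cpath[of f]] unfolding case_prod_unfold ext_def start_def .

lemma continuous_ext: "continuous_on S (ext f)"
  by (rule continuous_on_subset[OF cpath_props[THEN conjunct1] subset_UNIV])

lemma ext_before_start: "t \<le> start f \<Longrightarrow> ext f t = ext f (start f)"
  by (rule cpath_props[THEN conjunct2, rule_format])

lemma cpath_eqI: "start f = start g \<Longrightarrow> ext f = ext g \<Longrightarrow> f = g"
  unfolding start_def ext_def by (rule Rep_cpath_inject[THEN iffD1], rule prod_eqI)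

lemma Rep_tail: "Rep_cpath (tail f s) = (s, \<lambda>t. ext f (max s t))"
proof -
  have "continuous_on UNIV (\<lambda>t. ext f (max s t))"
    by (rule continuous_on_compose2[OF continuous_ext[of UNIV]]) (auto intro!: continuous_intros)
  then show ?thesis
    unfolding tail_def by (intro Abs_cpath_inverse) simp
qed

lemma start_tail: "start (tail f s) = s"
  and ext_tail: "ext (tail f s) t = ext f (max s t)"
  by (simp_all add: start_def ext_def[of "tail f s"] Rep_tail)

text \<open>
  One concrete choice of the metric \<open>\<delta>\<close> for uniform convergence on compacts.  Only the induced
  topology matters below.
\<close>

definition sup_dist :: "nat \<Rightarrow> (real \<Rightarrow> 'a :: metric_space) \<Rightarrow> (real \<Rightarrow> 'a) \<Rightarrow> real"
  where "sup_dist n f g = (SUP t\<in>{- real n..real n}. dist (f t) (g t))"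

definition ucc_dist :: "(real \<Rightarrow> 'a :: metric_space) \<Rightarrow> (real \<Rightarrow> 'a) \<Rightarrow> real"
  where "ucc_dist f g =
    (\<Sum>n. (1/2) ^ Suc n * min 1 (sup_dist n f g))"

lemma bdd_above_dist_ext:
  "bdd_above ((\<lambda>t. dist (ext f t) (ext g t)) ` {- real n..real n})"
proof -
  have "continuous_on {- real n..real n} (\<lambda>t. dist (ext f t) (ext g t))"
    by (rule continuous_on_dist[OF continuous_ext continuous_ext])
  from compact_continuous_image[OF this compact_Icc] show ?thesis
    by (rule bounded_imp_bdd_above[OF compact_imp_bounded])
qed

lemma dist_ext_le_sup_dist:
  "\<bar>t\<bar> \<le> real n \<Longrightarrow> dist (ext f t) (ext g t) \<le> sup_dist n (ext f) (ext g)"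
  unfolding sup_dist_def by (rule cSUP_upper[OF _ bdd_above_dist_ext]) auto

lemma sup_dist_ext_nonneg: "0 \<le> sup_dist n (ext f) (ext g)"
  by (rule order_trans[OF zero_le_dist dist_ext_le_sup_dist[of 0]]) simp

lemma sup_dist_ext_le:
  "(\<And>t. \<bar>t\<bar> \<le> real n \<Longrightarrow> dist (ext f t) (ext g t) \<le> c)
    \<Longrightarrow> sup_dist n (ext f) (ext g) \<le> c"
  unfolding sup_dist_def by (rule cSUP_least) auto

lemma ucc_dist_term_bounds:
  "0 \<le> (1/2) ^ Suc n * min 1 (sup_dist n (ext f) (ext g))"
  "(1/2) ^ Suc n * min 1 (sup_dist n (ext f) (ext g)) \<le> (1/2) ^ Suc n"
proof -
  let ?S = "sup_dist n (ext f) (ext g)"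
  have S: "0 \<le> min 1 ?S" "min 1 ?S \<le> 1"
    using sup_dist_ext_nonneg[of n f g] by linarith+
  have p: "0 \<le> (1/2 :: real) ^ Suc n"
    by (rule zero_le_power) linarith
  show "0 \<le> (1/2) ^ Suc n * min 1 ?S"
    by (rule mult_nonneg_nonneg[OF p S(1)])
  show "(1/2) ^ Suc n * min 1 ?S \<le> (1/2) ^ Suc n"
    by (rule mult_left_le[OF S(2) p])
qed

lemma summable_ucc_dist:
  "summable (\<lambda>n. (1/2) ^ Suc n * min 1 (sup_dist n (ext f) (ext g)))"
proof -
  have s: "summable (\<lambda>n. (1/2 :: real) ^ Suc n)"
    by (rule sums_summable[OF power_half_series])
  have "norm ((1/2) ^ Suc n * min 1 (sup_dist n (ext f) (ext g))) \<le> (1/2) ^ Suc n" for n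
    using ucc_dist_term_bounds[of n f g] unfolding real_norm_def by linarith
  then show ?thesis
    by (rule summable_comparison_test'[OF s])
qed

lemma ucc_dist_term_le:
  "(1/2) ^ Suc n * min 1 (sup_dist n (ext f) (ext g))
    \<le> ucc_dist (ext f) (ext g)"
proof -
  have "(\<Sum>n\<in>{n}. (1/2) ^ Suc n * min 1 (sup_dist n (ext f) (ext g))) \<le> ucc_dist (ext f) (ext g)"
    unfolding ucc_dist_def
    by (rule sum_le_suminf[OF summable_ucc_dist finite.insertI[OF finite.emptyI] ucc_dist_term_bounds(1)])
  then show ?thesis
    by simp
qed

lemma ucc_dist_nonneg: "0 \<le> ucc_dist (ext f) (ext g)"
  using ucc_dist_term_le[of 0 f g] ucc_dist_term_bounds(1)[of 0 f g] by linarith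

lemma ucc_dist_eq_0: "ucc_dist (ext f) (ext g) = 0 \<longleftrightarrow> ext f = ext g"
proof
  assume eq: "ucc_dist (ext f) (ext g) = 0"
  show "ext f = ext g"
  proof
    fix t
    obtain n where n: "\<bar>t\<bar> \<le> real n"
      using real_arch_simple by blast
    let ?S = "sup_dist n (ext f) (ext g)"
    have "(1/2) ^ Suc n * min 1 ?S \<le> 0"
      using ucc_dist_term_le[of n f g] unfolding eq .
    moreover have "0 < (1/2 :: real) ^ Suc n"
      by (rule zero_less_power) linarith
    ultimately have "min 1 ?S \<le> 0"
      by (simp only: mult_le_0_iff) linarith
    then have "?S \<le> 0"
      by linarith
    then have "dist (ext f t) (ext g t) \<le> 0"
      using dist_ext_le_sup_dist[OF n, of f g] by linarith
    then show "ext f t = ext g t"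
      by (simp only: dist_le_zero_iff)
  qed
next
  assume eq: "ext f = ext g"
  have "sup_dist n (ext g) (ext g) = 0" for n
    by (rule antisym[OF sup_dist_ext_le sup_dist_ext_nonneg]) simp
  then show "ucc_dist (ext f) (ext g) = 0"
    by (simp add: ucc_dist_def eq)
qed

lemma ucc_dist_triangle2:
  "ucc_dist (ext f) (ext g) \<le> ucc_dist (ext f) (ext h) + ucc_dist (ext g) (ext h)"
proof -
  have le: "sup_dist n (ext f) (ext g)
      \<le> sup_dist n (ext f) (ext h)
        + sup_dist n (ext g) (ext h)" for n
  proof (rule sup_dist_ext_le)
    fix t :: real assume t: "\<bar>t\<bar> \<le> real n"
    show "dist (ext f t) (ext g t) \<le> sup_dist n (ext f) (ext h)
        + sup_dist n (ext g) (ext h)"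
      using dist_ext_le_sup_dist[OF t, of f h] dist_ext_le_sup_dist[OF t, of g h]
        dist_triangle2[of "ext f t" "ext g t" "ext h t"] by linarith
  qed
  have "(1/2) ^ Suc n * min 1 (sup_dist n (ext f) (ext g))
      \<le> (1/2) ^ Suc n * min 1 (sup_dist n (ext f) (ext h))
        + (1/2) ^ Suc n * min 1 (sup_dist n (ext g) (ext h))" for n
  proof -
    have "min 1 (sup_dist n (ext f) (ext g))
      \<le> min 1 (sup_dist n (ext f) (ext h))
        + min 1 (sup_dist n (ext g) (ext h))"
      using le[of n] sup_dist_ext_nonneg[of n f h] sup_dist_ext_nonneg[of n g h] by linarith
    then show ?thesis
      unfolding distrib_left[symmetric] by (intro mult_left_mono) auto
  qed
  from suminf_le[OF this summable_ucc_dist summable_add[OF summable_ucc_dist summable_ucc_dist]]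
  show ?thesis
    unfolding ucc_dist_def suminf_add[OF summable_ucc_dist summable_ucc_dist] .
qed

instantiation cpath :: (metric_space) metric_space
begin

definition dist_cpath :: "'a cpath \<Rightarrow> 'a cpath \<Rightarrow> real"
  where "dist_cpath f g = \<bar>start f - start g\<bar> + ucc_dist (ext f) (ext g)"

definition uniformity_cpath :: "('a cpath \<times> 'a cpath) filter"
  where "uniformity_cpath = (INF e\<in>{0 <..}. principal {(f, g). dist f g < e})"

definition open_cpath :: "'a cpath set \<Rightarrow> bool"
  where "open_cpath U \<longleftrightarrow> (\<forall>f\<in>U. \<forall>\<^sub>F (f', g) in uniformity. f' = f \<longrightarrow> g \<in> U)"

instance
proof
  fix f g h :: "'a cpath"
  show "dist f g = 0 \<longleftrightarrow> f = g"
  proof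
    assume "dist f g = 0"
    then have "\<bar>start f - start g\<bar> = 0" "ucc_dist (ext f) (ext g) = 0"
      using ucc_dist_nonneg[of f g] by (auto simp: dist_cpath_def)
    then show "f = g"
      by (intro cpath_eqI) (auto simp: ucc_dist_eq_0)
  qed (simp add: dist_cpath_def ucc_dist_eq_0)
  show "dist f g \<le> dist f h + dist g h"
    using ucc_dist_triangle2[of f g h] by (simp add: dist_cpath_def)
qed (simp_all add: uniformity_cpath_def open_cpath_def)

end

lemma tendsto_cpath_iff:
  fixes f :: "nat \<Rightarrow> 'a :: metric_space cpath"
  shows "f \<longlonglongrightarrow> g \<longleftrightarrow> (\<lambda>k. start (f k)) \<longlonglongrightarrow> start g \<and>
    (\<forall>n. uniform_limit {- real n..real n} (\<lambda>k. ext (f k)) (ext g) sequentially)"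
proof (intro iffI conjI allI)
  assume lim: "f \<longlonglongrightarrow> g"
  have *: "(\<lambda>k. dist (f k) g) \<longlonglongrightarrow> 0"
    using lim by (rule tendsto_dist_iff[THEN iffD1])
  show "(\<lambda>k. start (f k)) \<longlonglongrightarrow> start g"
    unfolding tendsto_dist_iff[of "\<lambda>k. start (f k)"]
    by (rule tendsto_sandwich[OF _ _ tendsto_const *])
      (auto simp: dist_cpath_def dist_real_def ucc_dist_nonneg)
  fix n
  show "uniform_limit {- real n..real n} (\<lambda>k. ext (f k)) (ext g) sequentially"
  proof (rule uniform_limitI)
    fix e :: real assume e: "e > 0"
    have "(1/2) ^ Suc n * min 1 e > 0"
      using e by simp
    from order_tendstoD(2)[OF * this]
    show "\<forall>\<^sub>F k in sequentially. \<forall>t\<in>{- real n..real n}. dist (ext (f k) t) (ext g t) < e"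
    proof eventually_elim
      case (elim k)
      let ?S = "sup_dist n (ext (f k)) (ext g)"
      have "(1/2) ^ Suc n * min 1 ?S < (1/2) ^ Suc n * min 1 e"
      proof (rule le_less_trans[OF ucc_dist_term_le le_less_trans[OF _ elim]])
        show "ucc_dist (ext (f k)) (ext g) \<le> dist (f k) g"
          by (simp add: dist_cpath_def)
      qed
      then have "min 1 ?S < min 1 e"
        by (subst (asm) mult_less_cancel_left_pos) auto
      then have "?S < e"
        by linarith
      then show ?case
        by (intro ballI le_less_trans[OF dist_ext_le_sup_dist[of _ n "f k" g]]) auto
    qed
  qed
next
  assume lim: "(\<lambda>k. start (f k)) \<longlonglongrightarrow> start g \<and>
    (\<forall>n. uniform_limit {- real n..real n} (\<lambda>k. ext (f k)) (ext g) sequentially)"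
  define a where "a k n = (1/2) ^ Suc n *
    min 1 (sup_dist n (ext (f k)) (ext g))" for k n
  have a_lim: "(\<lambda>k. a k n) \<longlonglongrightarrow> 0" for n
  proof (rule tendstoI)
    fix e :: real assume e: "e > 0"
    have "\<forall>\<^sub>F k in sequentially. \<forall>t\<in>{- real n..real n}. dist (ext (f k) t) (ext g t) < e"
      using lim e by (auto dest: uniform_limitD)
    then show "\<forall>\<^sub>F k in sequentially. dist (a k n) 0 < e"
    proof eventually_elim
      case (elim k)
      let ?S = "sup_dist n (ext (f k)) (ext g)"
      have "?S \<le> e"
        by (rule sup_dist_ext_le) (use elim in \<open>auto simp: abs_le_iff intro: less_imp_le\<close>)
      then have "a k n \<le> (1/2) ^ Suc n * e"
        unfolding a_def by (intro mult_left_mono) auto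
      also have "\<dots> \<le> (1/2) * e"
        using e by (intro mult_right_mono) (auto simp: power_le_one)
      also have "\<dots> < e"
        using e by simp
      finally show ?case
        using ucc_dist_term_bounds(1)[of n "f k" g] by (simp add: a_def)
    qed
  qed
  have "norm (a k n) \<le> (1/2) ^ Suc n" for k n
    using ucc_dist_term_bounds[of n "f k" g] unfolding a_def real_norm_def by linarith
  then have bound: "\<forall>\<^sub>F (n, k) in at_top \<times>\<^sub>F sequentially. norm (a k n) \<le> (1/2) ^ Suc n"
    by (intro always_eventually) (simp del: power_Suc)
  have "(\<lambda>k. \<Sum>n. a k n) \<longlonglongrightarrow> (\<Sum>n. 0)"
    by (rule tannerys_theorem[where a = "\<lambda>n k. a k n" and b = "\<lambda>_. 0", OF a_lim bound
          sums_summable[OF power_half_series] trivial_limit_sequentially,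
          THEN conjunct2, THEN conjunct2])
  then have "(\<lambda>k. ucc_dist (ext (f k)) (ext g)) \<longlonglongrightarrow> 0"
    unfolding a_def ucc_dist_def by simp
  moreover have "(\<lambda>k. \<bar>start (f k) - start g\<bar>) \<longlonglongrightarrow> 0"
    using lim by (simp add: tendsto_dist_iff[of "\<lambda>k. start (f k)"] dist_real_def)
  ultimately show "f \<longlonglongrightarrow> g"
    unfolding tendsto_dist_iff[of f] dist_cpath_def using tendsto_add_zero by blast
qed


section \<open>Skeletons\<close>

definition started :: "(nat \<Rightarrow> 'a :: metric_space cpath) \<Rightarrow> real \<Rightarrow> nat set"
  where "started \<phi> s = {n. start (\<phi> n) \<le> s}"

text \<open>In the third condition both \<open>s\<close> and \<open>n\<close> vary.\<close>

definition skeleton :: "(nat \<Rightarrow> 'a :: metric_space cpath) \<Rightarrow> bool"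
  where "skeleton \<phi> \<longleftrightarrow>
    (\<forall>s. \<forall>m\<in>started \<phi> s. \<forall>n\<in>started \<phi> s. ext (\<phi> m) s = ext (\<phi> n) s \<longrightarrow>
        (\<forall>t\<ge>s. ext (\<phi> m) t = ext (\<phi> n) t)) \<and>
    closure (range (\<lambda>n. (start (\<phi> n), ext (\<phi> n) (start (\<phi> n))))) = UNIV \<and>
    (\<forall>L. compact L \<longrightarrow>
        compact (closure {tail (\<phi> n) s |n s. n \<in> started \<phi> s \<and> (s, ext (\<phi> n) s) \<in> L}))"


section \<open>The mapping \<open>\<Theta>\<close>\<close>

definition limit_selector :: "((nat \<Rightarrow> 'a :: metric_space cpath) \<Rightarrow> 'a cpath) \<Rightarrow> bool"
  where "limit_selector l \<longleftrightarrow>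
    l \<in> measurable (\<Pi>\<^sub>M n\<in>UNIV. borel) borel \<and>
    (\<forall>f. compact (closure (range f)) \<longrightarrow> (\<exists>r. strict_mono r \<and> (f \<circ> r) \<longlonglongrightarrow> l f))"

definition radii :: "(nat \<Rightarrow> 'a :: metric_space \<Rightarrow> real) \<Rightarrow> bool"
  where "radii \<epsilon> \<longleftrightarrow>
    (\<forall>k. \<epsilon> k \<in> borel_measurable borel) \<and> (\<forall>k x. 0 < \<epsilon> k x) \<and>
    (\<forall>x. decseq (\<lambda>k. \<epsilon> k x) \<and> (\<lambda>k. \<epsilon> k x) \<longlonglongrightarrow> 0)"

definition approx_index ::
    "(nat \<Rightarrow> 'a :: metric_space \<Rightarrow> real) \<Rightarrow> (nat \<Rightarrow> 'a cpath) \<Rightarrow> real \<Rightarrow> 'a \<Rightarrow> nat \<Rightarrow> nat"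
  where "approx_index \<epsilon> \<phi> s x k = Inf {n \<in> started \<phi> s. dist (ext (\<phi> n) s) x < \<epsilon> k x}"

definition Theta ::
    "((nat \<Rightarrow> 'a :: metric_space cpath) \<Rightarrow> 'a cpath) \<Rightarrow> (nat \<Rightarrow> 'a \<Rightarrow> real) \<Rightarrow>
      real \<Rightarrow> 'a \<Rightarrow> (nat \<Rightarrow> 'a cpath) \<Rightarrow> 'a cpath"
  where "Theta l \<epsilon> s x \<phi> = l (\<lambda>k. tail (\<phi> (approx_index \<epsilon> \<phi> s x k)) s)"


section \<open>Bifurcation points\<close>

definition nearby_paths ::
    "(nat \<Rightarrow> 'a :: metric_space cpath) \<Rightarrow> real \<Rightarrow> real \<Rightarrow> 'a \<Rightarrow> real \<Rightarrow> (real \<Rightarrow> 'a) set"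
  where "nearby_paths \<phi> s t x \<epsilon> =
    mtopology_of (cfunspace (top_of_set {s..t}) euclidean_metric) closure_of
      {restrict (ext (\<phi> n)) {s..t} |n. n \<in> started \<phi> s \<and> ext (\<phi> n) s \<in> ball x \<epsilon>}"

definition limit_paths ::
    "(nat \<Rightarrow> 'a :: metric_space cpath) \<Rightarrow> real \<Rightarrow> real \<Rightarrow> 'a \<Rightarrow> (real \<Rightarrow> 'a) set"
  where "limit_paths \<phi> s t x = (\<Inter>\<epsilon>\<in>{0<..}. nearby_paths \<phi> s t x \<epsilon>)"

definition num_limit_paths ::
    "(nat \<Rightarrow> 'a :: metric_space cpath) \<Rightarrow> real \<Rightarrow> real \<Rightarrow> 'a \<Rightarrow> enat"
  where "num_limit_paths \<phi> s t x =
    (if finite (limit_paths \<phi> s t x) then enat (card (limit_paths \<phi> s t x)) else \<infinity>)"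

definition split_time :: "(nat \<Rightarrow> 'a :: metric_space cpath) \<Rightarrow> real \<Rightarrow> 'a \<Rightarrow> ereal"
  where "split_time \<phi> s x = Inf {ereal t |t. s < t \<and> 2 \<le> num_limit_paths \<phi> s t x}"

definition bifurcation_points :: "(nat \<Rightarrow> 'a :: metric_space cpath) \<Rightarrow> (real \<times> 'a) set"
  where "bifurcation_points \<phi> = {(s, x). split_time \<phi> s x = ereal s}"


section \<open>Construction of \<open>\<psi>\<close>\<close>

text \<open>
  Here \<open>\<theta> s t x\<close> stands for \<open>\<theta>\<^sub>s\<^sub>,\<^sub>t(x)\<close>.  The values of \<open>sigma\<close> that occur as times of \<open>\<theta>\<close> are finite
  whenever the value is used, so that \<open>real_of_ereal\<close> is the identity there.
\<close>

fun sigma :: "(real \<Rightarrow> real \<Rightarrow> 'a \<Rightarrow> 'a) \<Rightarrow> (real \<times> 'a) set \<Rightarrow> real \<Rightarrow> 'a \<Rightarrow> nat \<Rightarrow> ereal"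
  and zpt :: "(real \<Rightarrow> real \<Rightarrow> 'a \<Rightarrow> 'a) \<Rightarrow> (real \<times> 'a) set \<Rightarrow> real \<Rightarrow> 'a \<Rightarrow> nat \<Rightarrow> 'a"
where
  "sigma \<theta> F s x 0 = ereal s"
| "sigma \<theta> F s x (Suc k) =
    (if sigma \<theta> F s x k < \<infinity>
     then Inf {ereal t |t. sigma \<theta> F s x k < ereal t \<and>
                 (t, \<theta> (real_of_ereal (sigma \<theta> F s x k)) t (zpt \<theta> F s x k)) \<in> F}
     else \<infinity>)"
| "zpt \<theta> F s x 0 = x"
| "zpt \<theta> F s x (Suc k) =
    (if sigma \<theta> F s x (Suc k) < \<infinity>
     then \<theta> (real_of_ereal (sigma \<theta> F s x k)) (real_of_ereal (sigma \<theta> F s x (Suc k))) (zpt \<theta> F s x k)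
     else x)"

definition stop_index ::
    "(real \<Rightarrow> real \<Rightarrow> 'a \<Rightarrow> 'a) \<Rightarrow> (real \<times> 'a) set \<Rightarrow> real \<Rightarrow> 'a \<Rightarrow> enat"
  where "stop_index \<theta> F s x = Inf {enat k |k. sigma \<theta> F s x k = sigma \<theta> F s x (Suc k)}"

definition sigma_lim ::
    "(real \<Rightarrow> real \<Rightarrow> 'a \<Rightarrow> 'a) \<Rightarrow> (real \<times> 'a) set \<Rightarrow> real \<Rightarrow> 'a \<Rightarrow> ereal"
  where "sigma_lim \<theta> F s x = lim (\<lambda>k. sigma \<theta> F s x k)"

text \<open>Only meaningful for \<open>s \<le> t\<close>; the index chosen in the first case is then unique.\<close>

definition psi :: "(real \<Rightarrow> real \<Rightarrow> 'a \<Rightarrow> 'a) \<Rightarrow> (real \<times> 'a) set \<Rightarrow> real \<Rightarrow> real \<Rightarrow> 'a \<Rightarrow> 'a"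
  where "psi \<theta> F s t x =
    (if ereal t < sigma_lim \<theta> F s x then
       (let k = (THE k. enat k < stop_index \<theta> F s x \<and>
                   sigma \<theta> F s x k \<le> ereal t \<and> ereal t < sigma \<theta> F s x (Suc k))
        in \<theta> (real_of_ereal (sigma \<theta> F s x k)) t (zpt \<theta> F s x k))
     else if stop_index \<theta> F s x < \<infinity> then
       (let k = the_enat (stop_index \<theta> F s x)
        in \<theta> (real_of_ereal (sigma \<theta> F s x k)) t (zpt \<theta> F s x k))
     else x)"

end

theory Submission
  imports Defs
begin

text \<open>
  The map \<open>\<theta>\<close> may fail the flow property only at bifurcation points: if \<open>(t, \<theta>\<^sub>s\<^sub>,\<^sub>t(x))\<close> is not one, then
  \<open>\<theta>\<close> started at \<open>(s, x)\<close> and \<open>\<theta>\<close> restarted at time \<open>t\<close> are both limits of skeleton paths passing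
  near that point, hence agree for a while; continuing the argument, they agree up to the first time
  \<open>\<sigma>\<close> at which \<open>\<theta>\<close> meets \<open>F\<close> after time \<open>s\<close>.  The family \<open>\<psi>\<close> follows \<open>\<theta>\<close> until \<open>\<sigma>\<close> and is
  restarted from there, so that \<open>\<psi>\<^sub>s\<^sub>,\<^sub>t(x) = \<psi>\<^sub>\<sigma>\<^sub>,\<^sub>t(\<theta>\<^sub>s\<^sub>,\<^sub>\<sigma>(x))\<close> for \<open>t \<ge> \<sigma>\<close>.  By (a) this restarting
  terminates, and all three claims follow by induction on the number of restarts; at the last one
  with \<open>\<sigma> = s\<close>, hypothesis (b) puts \<open>\<theta>\<close> on a skeleton path immediately, and \<open>\<psi>\<close> preserves
  skeleton paths because \<open>\<theta>\<close> does.
\<close>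

section \<open>Restarting at hitting times\<close>

declare sigma.simps(2) [simp del] zpt.simps(2) [simp del]

text \<open>Isolates the combinatorics of the restarts, valid for any map with
  \<open>\<theta> s s x = x\<close>; skeletons and topology enter only afterwards.\<close>

locale hitting_scheme =
  fixes \<theta> :: "real \<Rightarrow> real \<Rightarrow> 'a \<Rightarrow> 'a" and F :: "(real \<times> 'a) set"
  assumes theta_start: "\<theta> s s x = x"
begin

section \<open>Monotonicity and stationarity of the hitting times\<close>

lemma sigma_le_Suc: "sigma \<theta> F s x k \<le> sigma \<theta> F s x (Suc k)"
  by (auto simp: sigma.simps(2) intro!: Inf_greatest)

lemma sigma_mono: "j \<le> k \<Longrightarrow> sigma \<theta> F s x j \<le> sigma \<theta> F s x k"
  using lift_Suc_mono_le[of "sigma \<theta> F s x", OF sigma_le_Suc] .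

lemma start_le_sigma: "ereal s \<le> sigma \<theta> F s x k"
  using sigma_mono[of 0 k s x] by simp

lemma sigma_cases:
  obtains (real) r where "sigma \<theta> F s x k = ereal r" "s \<le> r"
  | (infinite) "sigma \<theta> F s x k = \<infinity>"
  using start_le_sigma[of s x k] by (cases "sigma \<theta> F s x k") auto

lemma sigma_first_hit_le:
  "s < t \<Longrightarrow> (t, \<theta> s t x) \<in> F \<Longrightarrow> sigma \<theta> F s x (Suc 0) \<le> ereal t"
  by (auto simp: sigma.simps(2) intro!: Inf_lower)

text \<open>The next hitting time depends only on the current time and point. Restarting at an
  unchanged finite time leaves the point fixed, by \<open>theta_start\<close>, so one repetition
  freezes the whole scheme.\<close>

lemma sigma_stationary:
  assumes "sigma \<theta> F s x k = sigma \<theta> F s x (Suc k)"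
  shows "sigma \<theta> F s x (k + j) = sigma \<theta> F s x k \<and>
    (sigma \<theta> F s x k < \<infinity> \<longrightarrow> zpt \<theta> F s x (k + j) = zpt \<theta> F s x k)"
proof (induction j)
  case (Suc j)
  show ?case
  proof (cases rule: sigma_cases[of s x k])
    case (real r)
    have j: "sigma \<theta> F s x (k + j) = ereal r" "zpt \<theta> F s x (k + j) = zpt \<theta> F s x k"
      using Suc real(1) by simp_all
    have "sigma \<theta> F s x (Suc (k + j)) = sigma \<theta> F s x (Suc k)"
      unfolding sigma.simps(2)[of \<theta> F s x k] sigma.simps(2)[of \<theta> F s x "k + j"] j real(1) ..
    then have *: "sigma \<theta> F s x (Suc (k + j)) = ereal r"
      using assms real(1) by simp
    have "zpt \<theta> F s x (Suc (k + j)) = zpt \<theta> F s x k"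
      unfolding zpt.simps(2)[of \<theta> F s x "k + j"] * j by (simp add: theta_start)
    with * real(1) show ?thesis by simp
  next
    case infinite
    with Suc show ?thesis by (simp add: sigma.simps(2)[of \<theta> F s x "k + j"])
  qed
qed simp

lemma sigma_stationary_ge:
  assumes "sigma \<theta> F s x k = sigma \<theta> F s x (Suc k)" and "k \<le> m"
  shows "sigma \<theta> F s x m = sigma \<theta> F s x k"
    and "sigma \<theta> F s x k < \<infinity> \<Longrightarrow> zpt \<theta> F s x m = zpt \<theta> F s x k"
  using sigma_stationary[OF assms(1), of "m - k"] assms(2) by auto

lemma sigma_lim_eq_SUP: "sigma_lim \<theta> F s x = (SUP k. sigma \<theta> F s x k)"
  unfolding sigma_lim_def by (intro limI LIMSEQ_SUP monoI sigma_mono)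

text \<open>A finite infimum in \<open>enat\<close> comes from a nonempty set and is attained there,
  by well-ordering.\<close>

lemma stop_index_stationary:
  assumes "stop_index \<theta> F s x < \<infinity>"
  obtains j where "stop_index \<theta> F s x = enat j" "sigma \<theta> F s x j = sigma \<theta> F s x (Suc j)"
proof -
  let ?A = "{enat k |k. sigma \<theta> F s x k = sigma \<theta> F s x (Suc k)}"
  have "?A \<noteq> {}"
    using assms unfolding stop_index_def Inf_enat_def by (auto split: if_splits)
  then have "Inf ?A \<in> ?A"
    unfolding Inf_enat_def using LeastI_ex[of "\<lambda>x. x \<in> ?A"] by (metis (no_types, lifting) ex_in_conv)
  then show thesis
    using that unfolding stop_index_def by blast
qed

lemma stop_index_le: "sigma \<theta> F s x k = sigma \<theta> F s x (Suc k) \<Longrightarrow> stop_index \<theta> F s x \<le> enat k"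
  unfolding stop_index_def by (rule Inf_lower) blast

lemma stop_index_eq_0:
  assumes "sigma \<theta> F s x (Suc 0) = ereal s"
  shows "stop_index \<theta> F s x = 0"
  using stop_index_le[of s x 0] assms by (simp add: zero_enat_def[symmetric])

section \<open>Values of \<open>psi\<close> read off from the hitting times\<close>

text \<open>Frees \<open>psi\<close> from its definite description. A strict increase of the times
  at \<open>k\<close> puts \<open>k\<close> below the stop index, since the times are constant from
  there on; monotonicity makes the index unique.\<close>

lemma psi_between:
  assumes k: "sigma \<theta> F s x k \<le> ereal t" "ereal t < sigma \<theta> F s x (Suc k)"
  shows "psi \<theta> F s t x = \<theta> (real_of_ereal (sigma \<theta> F s x k)) t (zpt \<theta> F s x k)"
proof -
  have lim: "ereal t < sigma_lim \<theta> F s x"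
    unfolding sigma_lim_eq_SUP using k(2) by (rule less_SUP_iff[THEN iffD2, OF bexI]) simp
  have stop: "enat k < stop_index \<theta> F s x"
  proof (rule ccontr)
    assume *: "\<not> enat k < stop_index \<theta> F s x"
    then have "stop_index \<theta> F s x \<le> enat k" by simp
    then have "stop_index \<theta> F s x < \<infinity>" by (rule le_less_trans) simp
    then obtain j where j: "stop_index \<theta> F s x = enat j"
        "sigma \<theta> F s x j = sigma \<theta> F s x (Suc j)"
      by (rule stop_index_stationary)
    with * have "j \<le> k" by simp
    then have "sigma \<theta> F s x (Suc k) = sigma \<theta> F s x k"
      using sigma_stationary_ge(1)[OF j(2), of k] sigma_stationary_ge(1)[OF j(2), of "Suc k"]
      by simp
    with k show False by simp
  qed
  have "(THE k. enat k < stop_index \<theta> F s x \<and>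
      sigma \<theta> F s x k \<le> ereal t \<and> ereal t < sigma \<theta> F s x (Suc k)) = k"
  proof (rule the_equality)
    fix m assume m: "enat m < stop_index \<theta> F s x \<and>
      sigma \<theta> F s x m \<le> ereal t \<and> ereal t < sigma \<theta> F s x (Suc m)"
    show "m = k"
    proof (rule linorder_cases[of m k])
      assume "m < k"
      then have "sigma \<theta> F s x (Suc m) \<le> sigma \<theta> F s x k" by (intro sigma_mono) simp
      with m k show ?thesis by (meson leD le_less_trans less_le_trans)
    next
      assume "k < m"
      then have "sigma \<theta> F s x (Suc k) \<le> sigma \<theta> F s x m" by (intro sigma_mono) simp
      with m k show ?thesis by (meson leD le_less_trans less_le_trans)
    qed
  qed (use k stop in blast)
  with lim show ?thesis by (simp only: psi_def Let_def if_True)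
qed

text \<open>The definition uses the least stationary index, but every later index has the same time
  and point, so any stationary \<open>k\<close> serves.\<close>

lemma psi_stationary:
  assumes k: "sigma \<theta> F s x k = sigma \<theta> F s x (Suc k)"
    and r: "sigma \<theta> F s x k = ereal r" "r \<le> t"
  shows "psi \<theta> F s t x = \<theta> r t (zpt \<theta> F s x k)"
proof -
  have "stop_index \<theta> F s x < \<infinity>"
    using stop_index_le[OF k] by (rule le_less_trans) simp
  then obtain j where j: "stop_index \<theta> F s x = enat j"
      "sigma \<theta> F s x j = sigma \<theta> F s x (Suc j)"
    by (rule stop_index_stationary)
  have jk: "j \<le> k"
    using stop_index_le[OF k] j(1) by simp
  have sj: "sigma \<theta> F s x j = ereal r"
    using sigma_stationary_ge(1)[OF j(2) jk] r by simp
  have zj: "zpt \<theta> F s x k = zpt \<theta> F s x j"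
    using sigma_stationary_ge(2)[OF j(2) jk] sj by simp
  have "sigma \<theta> F s x m \<le> ereal r" for m
    using sigma_stationary_ge(1)[OF j(2), of m] sigma_mono[of m j s x] sj by (cases "j \<le> m") auto
  then have "sigma_lim \<theta> F s x \<le> ereal r"
    unfolding sigma_lim_eq_SUP by (rule SUP_least)
  then have "\<not> ereal t < sigma_lim \<theta> F s x"
    using r(2) by (meson ereal_less_eq(3) leD order_trans)
  then show ?thesis
    by (simp add: psi_def j(1) sj zj)
qed

lemma psi_stop:
  "sigma \<theta> F s x (Suc 0) = ereal s \<Longrightarrow> s \<le> t \<Longrightarrow> psi \<theta> F s t x = \<theta> s t x"
  using psi_stationary[of s x 0 s t] by simp

lemma psi_before:
  "s \<le> t \<Longrightarrow> ereal t < sigma \<theta> F s x (Suc 0) \<Longrightarrow> psi \<theta> F s t x = \<theta> s t x"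
  using psi_between[of s x 0 t] by simp

lemma psi_start: "psi \<theta> F s s x = x"
proof (cases "sigma \<theta> F s x (Suc 0) = ereal s")
  case False
  then have "ereal s < sigma \<theta> F s x (Suc 0)"
    using start_le_sigma[of s x "Suc 0"] by simp
  from psi_before[OF order_refl this] show ?thesis by (simp only: theta_start)
qed (simp add: psi_stop theta_start)

section \<open>Shifting the scheme by one restart\<close>

text \<open>Both schemes run the same recursion from the same time and point. The points are
  compared only at finite times: at infinite ones they are reset to different initial points,
  \<open>x\<close> and \<open>\<theta> s r x\<close>.\<close>

lemma sigma_shift:
  assumes "sigma \<theta> F s x (Suc 0) = ereal r"
  shows "sigma \<theta> F s x (Suc k) = sigma \<theta> F r (\<theta> s r x) k \<and>
    (sigma \<theta> F s x (Suc k) < \<infinity> \<longrightarrow> zpt \<theta> F s x (Suc k) = zpt \<theta> F r (\<theta> s r x) k)"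
proof (induction k)
  case 0
  show ?case
    unfolding zpt.simps(2)[of \<theta> F s x 0] assms by simp
next
  case (Suc k)
  show ?case
  proof (cases "sigma \<theta> F s x (Suc k) < \<infinity>")
    case True
    then have z: "zpt \<theta> F s x (Suc k) = zpt \<theta> F r (\<theta> s r x) k"
      using Suc by blast
    have sig: "sigma \<theta> F s x (Suc k) = sigma \<theta> F r (\<theta> s r x) k"
      using Suc by blast
    have "sigma \<theta> F s x (Suc (Suc k)) = sigma \<theta> F r (\<theta> s r x) (Suc k)"
      unfolding sigma.simps(2)[of \<theta> F s x "Suc k"] sigma.simps(2)[of \<theta> F r "\<theta> s r x" k] sig z
      by (rule refl)
    moreover have "zpt \<theta> F s x (Suc (Suc k)) = zpt \<theta> F r (\<theta> s r x) (Suc k)"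
      if "sigma \<theta> F r (\<theta> s r x) (Suc k) < \<infinity>"
      unfolding zpt.simps(2)[of \<theta> F s x "Suc k"] zpt.simps(2)[of \<theta> F r "\<theta> s r x" k]
        calculation sig z if_P[OF that] by (rule refl)
    ultimately show ?thesis
      by simp
  next
    case False
    then have "\<not> sigma \<theta> F r (\<theta> s r x) k < \<infinity>"
      using Suc by argo
    then have "sigma \<theta> F r (\<theta> s r x) (Suc k) = \<infinity>"
      unfolding sigma.simps(2)[of \<theta> F r "\<theta> s r x" k] by (rule if_not_P)
    moreover have "sigma \<theta> F s x (Suc (Suc k)) = \<infinity>"
      unfolding sigma.simps(2)[of \<theta> F s x "Suc k"] using False by (rule if_not_P)
    ultimately show ?thesis
      by (metis less_irrefl)
  qed
qed

lemma psi_after: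
  assumes r: "sigma \<theta> F s x (Suc 0) = ereal r" "r \<le> t"
    and stationary: "sigma \<theta> F s x k = sigma \<theta> F s x (Suc k)"
  shows "psi \<theta> F s t x = psi \<theta> F r t (\<theta> s r x)"
proof (cases "ereal t < sigma \<theta> F s x k")
  case True
  \<comment> \<open>The first hitting time beyond \<open>t\<close>; since \<open>t\<close> is not
    before the first hit, \<open>j\<close> is at least 2, and the interval containing
    \<open>t\<close> survives the shift.\<close>
  define j where "j = (LEAST j. ereal t < sigma \<theta> F s x j)"
  have j: "ereal t < sigma \<theta> F s x j"
    unfolding j_def using True by (rule LeastI)
  have "sigma \<theta> F s x (Suc 0) \<le> ereal t"
    using r by simp
  with j have "\<not> sigma \<theta> F s x j \<le> sigma \<theta> F s x (Suc 0)"
    by (meson leD order_trans)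
  then have "\<not> j \<le> Suc 0"
    using sigma_mono by blast
  then obtain i where i: "j = Suc (Suc i)"
    using that[of "j - 2"] by simp
  have less: "ereal t < sigma \<theta> F s x (Suc (Suc i))"
    using j i by simp
  have le: "sigma \<theta> F s x (Suc i) \<le> ereal t"
  proof (rule leI)
    have "Suc i < j" using i by simp
    then show "\<not> ereal t < sigma \<theta> F s x (Suc i)"
      unfolding j_def by (rule not_less_Least)
  qed
  have fin: "sigma \<theta> F s x (Suc i) < \<infinity>"
    using le by (rule le_less_trans) simp
  have sh: "sigma \<theta> F s x (Suc (Suc i)) = sigma \<theta> F r (\<theta> s r x) (Suc i)"
      "sigma \<theta> F s x (Suc i) = sigma \<theta> F r (\<theta> s r x) i"
      "zpt \<theta> F s x (Suc i) = zpt \<theta> F r (\<theta> s r x) i"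
    using sigma_shift[OF r(1), of "Suc i"] sigma_shift[OF r(1), of i] fin by (simp_all only:)
  show ?thesis
    using psi_between[OF le less] psi_between[of r "\<theta> s r x" i t] le less unfolding sh by (simp only:)
next
  case False
  \<comment> \<open>The shift speaks only of successor indices and \<open>k\<close> may be 0, so the
    stationary index is raised by one.\<close>
  have stat': "sigma \<theta> F s x (Suc k) = sigma \<theta> F s x (Suc (Suc k))"
    using sigma_stationary_ge(1)[OF stationary, of "Suc k"]
      sigma_stationary_ge(1)[OF stationary, of "Suc (Suc k)"] by simp
  obtain q where q: "sigma \<theta> F s x (Suc k) = ereal q" "q \<le> t"
    using False[unfolded stationary] by (cases rule: sigma_cases[of s x "Suc k"]) auto
  have sh: "sigma \<theta> F s x (Suc (Suc k)) = sigma \<theta> F r (\<theta> s r x) (Suc k)"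
      "sigma \<theta> F s x (Suc k) = sigma \<theta> F r (\<theta> s r x) k"
      "zpt \<theta> F s x (Suc k) = zpt \<theta> F r (\<theta> s r x) k"
    using sigma_shift[OF r(1), of "Suc k"] sigma_shift[OF r(1), of k] q by simp_all
  show ?thesis
    using psi_stationary[OF stat' q] psi_stationary[OF _ _ q(2), of r "\<theta> s r x" k]
    by (metis q(1) sh stat')
qed

text \<open>Induction on an index where the hitting times become stationary: passing to the first
  hit lowers that index by one. The \<open>hit\<close> case carries the restart identity for
  \<open>psi\<close> along.\<close>

lemma first_hit_induct [consumes 1, case_names stop infinite hit]:
  assumes "stop_index \<theta> F s x < \<infinity>"
    and stop: "\<And>s x. sigma \<theta> F s x (Suc 0) = ereal s \<Longrightarrow> P s x"
    and infinite: "\<And>s x. sigma \<theta> F s x (Suc 0) = \<infinity> \<Longrightarrow> P s x"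
    and hit: "\<And>s x r. sigma \<theta> F s x (Suc 0) = ereal r \<Longrightarrow> s < r \<Longrightarrow>
      (\<And>t. r \<le> t \<Longrightarrow> psi \<theta> F s t x = psi \<theta> F r t (\<theta> s r x)) \<Longrightarrow> P r (\<theta> s r x) \<Longrightarrow> P s x"
  shows "P s x"
proof -
  obtain k where "sigma \<theta> F s x k = sigma \<theta> F s x (Suc k)"
    using assms(1) by (rule stop_index_stationary)
  then show ?thesis
  proof (induction k arbitrary: s x)
    case 0
    then show ?case by (intro stop) simp
  next
    case (Suc k)
    show ?case
    proof (cases rule: sigma_cases[of s x "Suc 0"])
      case (real r)
      show ?thesis
      proof (cases "s = r")
        case True
        with real show ?thesis by (intro stop) simp
      next
        case False
        have "P r (\<theta> s r x)"
          using sigma_shift[OF real(1), of k] sigma_shift[OF real(1), of "Suc k"] Suc.prems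
          by (intro Suc.IH) metis
        then show ?thesis
          using False real(2) psi_after[OF real(1) _ Suc.prems] by (intro hit[OF real(1)]) auto
      qed
    qed (rule infinite)
  qed
qed

end

section \<open>Paths selected from a skeleton\<close>

lemma uniform_limit_ext:
  assumes "f \<longlonglongrightarrow> g"
  shows "uniform_limit {a..b} (\<lambda>k. ext (f k)) (ext g) sequentially"
proof -
  obtain n where "max \<bar>a\<bar> \<bar>b\<bar> \<le> real n"
    using real_arch_simple by blast
  then have "{a..b} \<subseteq> {- real n..real n}" by auto
  then show ?thesis
    using assms unfolding tendsto_cpath_iff by (meson uniform_limit_on_subset)
qed

lemma tendsto_ext: "f \<longlonglongrightarrow> g \<Longrightarrow> (\<lambda>k. ext (f k) t) \<longlonglongrightarrow> ext g t"
  by (rule tendsto_uniform_limitI[OF uniform_limit_ext[of f g t t]]) simp_all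

lemma
  assumes "skeleton \<phi>"
  shows skeleton_coalesce: "m \<in> started \<phi> s \<Longrightarrow> n \<in> started \<phi> s \<Longrightarrow>
      ext (\<phi> m) s = ext (\<phi> n) s \<Longrightarrow> s \<le> t \<Longrightarrow> ext (\<phi> m) t = ext (\<phi> n) t"
    and skeleton_compact: "compact L \<Longrightarrow>
      compact (closure {tail (\<phi> n) s |n s. n \<in> started \<phi> s \<and> (s, ext (\<phi> n) s) \<in> L})"
proof -
  note * = assms[unfolded skeleton_def]
  show "m \<in> started \<phi> s \<Longrightarrow> n \<in> started \<phi> s \<Longrightarrow>
      ext (\<phi> m) s = ext (\<phi> n) s \<Longrightarrow> s \<le> t \<Longrightarrow> ext (\<phi> m) t = ext (\<phi> n) t"
    by (rule conjunct1[OF *, rule_format])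
  show "compact L \<Longrightarrow>
      compact (closure {tail (\<phi> n) s |n s. n \<in> started \<phi> s \<and> (s, ext (\<phi> n) s) \<in> L})"
    by (rule conjunct2[OF conjunct2[OF *], rule_format])
qed

lemma skeleton_start_dense:
  assumes "skeleton \<phi>" "0 < e"
  obtains n where "s - e < start (\<phi> n)" "start (\<phi> n) < s"
    "dist (ext (\<phi> n) (start (\<phi> n))) x < e"
proof -
  let ?D = "range (\<lambda>n. (start (\<phi> n), ext (\<phi> n) (start (\<phi> n))))"
  let ?U = "{s - e<..<s} \<times> ball x e"
  \<comment> \<open>The box lies strictly before \<open>s\<close>, so that a path found in it has
    already started at time \<open>s\<close>.\<close>
  have "(s - e / 2, x) \<in> ?U \<inter> closure ?D"
    using assms unfolding skeleton_def by simp
  moreover have "open ?U"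
    by (intro open_Times) auto
  ultimately have "?U \<inter> ?D \<noteq> {}"
    using open_Int_closure_eq_empty[of ?U ?D] by blast
  then show thesis
    by (auto simp: dist_commute intro: that)
qed

text \<open>A limit of skeleton paths started at points tending to \<open>(s, x)\<close> from the past is constantly
  \<open>x\<close> up to time \<open>s\<close>, and convergence of its extension at a time before all starts gives the claim.\<close>

lemma skeleton_near:
  fixes \<phi> :: "nat \<Rightarrow> 'a :: heine_borel cpath"
  assumes \<phi>: "skeleton \<phi>" and e: "0 < e"
  obtains n where "n \<in> started \<phi> s" "dist (ext (\<phi> n) s) x < e"
proof -
  have "\<exists>n. s - inverse (real (Suc j)) < start (\<phi> n) \<and> start (\<phi> n) < s \<and>
      dist (ext (\<phi> n) (start (\<phi> n))) x < inverse (real (Suc j))" for j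
    using skeleton_start_dense[OF \<phi>, of "inverse (real (Suc j))" s x]
    by (metis inverse_positive_iff_positive of_nat_0_less_iff zero_less_Suc)
  then obtain n where n: "s - inverse (real (Suc j)) < start (\<phi> (n j))" "start (\<phi> (n j)) < s"
      "dist (ext (\<phi> (n j)) (start (\<phi> (n j)))) x < inverse (real (Suc j))" for j
    by metis
  \<comment> \<open>A compact box holding all the starting points; the third skeleton condition,
    with varying initial times, then gives a convergent subsequence.\<close>
  let ?L = "{s - 1..s} \<times> cball x 1"
  let ?K = "closure {tail (\<phi> n) s |n s. n \<in> started \<phi> s \<and> (s, ext (\<phi> n) s) \<in> ?L}"
  define f where "f j = tail (\<phi> (n j)) (start (\<phi> (n j)))" for j
  have le1: "inverse (real (Suc j)) \<le> 1" for j
    by (simp add: inverse_le_1_iff)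
  have late: "s - 1 \<le> start (\<phi> (n j))" for j
    using n(1)[of j] le1[of j] by linarith
  have "f j \<in> ?K" for j
  proof (rule closure_subset[THEN subsetD], unfold f_def, intro CollectI exI conjI)
    show "n j \<in> started \<phi> (start (\<phi> (n j)))"
      by (simp add: started_def)
    show "(start (\<phi> (n j)), ext (\<phi> (n j)) (start (\<phi> (n j)))) \<in> ?L"
      using n(2,3)[of j] late[of j] le1[of j] by (auto simp: dist_commute)
  qed simp
  moreover have "compact ?K"
    by (intro skeleton_compact[OF \<phi>] compact_Times compact_Icc compact_cball)
  ultimately obtain g r where r: "strict_mono r" and lim: "(f \<circ> r) \<longlonglongrightarrow> g"
    unfolding compact_def by blast
  have inv: "(\<lambda>j. inverse (real (Suc (r j)))) \<longlonglongrightarrow> 0"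
    using LIMSEQ_subseq_LIMSEQ[OF LIMSEQ_inverse_real_of_nat r] by (simp add: o_def)
  have "(\<lambda>j. start (\<phi> (n (r j)))) \<longlonglongrightarrow> s"
  proof (rule tendsto_sandwich)
    show "(\<lambda>j. s - inverse (real (Suc (r j)))) \<longlonglongrightarrow> s"
      using tendsto_diff[OF tendsto_const inv, of s] by simp
    show "\<forall>\<^sub>F j in sequentially. s - inverse (real (Suc (r j))) \<le> start (\<phi> (n (r j)))"
      using n(1) by (intro always_eventually allI less_imp_le)
    show "\<forall>\<^sub>F j in sequentially. start (\<phi> (n (r j))) \<le> s"
      using n(2) by (intro always_eventually allI less_imp_le)
  qed simp
  moreover have "(\<lambda>j. start (\<phi> (n (r j)))) \<longlonglongrightarrow> start g"
    using lim unfolding tendsto_cpath_iff by (simp add: f_def start_tail)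
  ultimately have start_g: "start g = s"
    using LIMSEQ_unique by blast
  have "(\<lambda>j. ext (\<phi> (n (r j))) (start (\<phi> (n (r j))))) \<longlonglongrightarrow> ext g (s - 1)"
    using tendsto_ext[OF lim, of "s - 1"] late by (simp add: f_def ext_tail max_absorb1)
  moreover have "(\<lambda>j. ext (\<phi> (n (r j))) (start (\<phi> (n (r j))))) \<longlonglongrightarrow> x"
  proof (rule metric_tendsto_imp_tendsto[OF inv])
    show "\<forall>\<^sub>F j in sequentially. dist (ext (\<phi> (n (r j))) (start (\<phi> (n (r j))))) x
        \<le> dist (inverse (real (Suc (r j)))) 0"
      using n(3) by (intro always_eventually allI) (auto simp: less_imp_le)
  qed
  ultimately have "ext g (s - 1) = x"
    using LIMSEQ_unique by blast
  then have "ext g s = x"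
    using ext_before_start[of "s - 1" g] start_g by simp
  moreover have "(\<lambda>j. ext (\<phi> (n (r j))) s) \<longlonglongrightarrow> ext g s"
    using tendsto_ext[OF lim, of s] n(2) by (simp add: f_def ext_tail max_absorb2 less_imp_le)
  ultimately have "\<forall>\<^sub>F j in sequentially. dist (ext (\<phi> (n (r j))) s) x < e"
    using e by (auto dest: tendstoD)
  from eventually_happens'[OF sequentially_bot this]
  obtain j where "dist (ext (\<phi> (n (r j))) s) x < e" ..
  then show thesis
    using n(2)[of "r j"] by (intro that[of "n (r j)"]) (simp_all add: started_def)
qed

text \<open>The index set is nonempty by \<open>skeleton_near\<close>, and an infimum of naturals
  over a nonempty set is attained.\<close>

lemma approx_index_near:
  fixes \<phi> :: "nat \<Rightarrow> 'a :: heine_borel cpath"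
  assumes "skeleton \<phi>" "radii \<epsilon>"
  shows "approx_index \<epsilon> \<phi> s x k \<in> started \<phi> s"
    and "dist (ext (\<phi> (approx_index \<epsilon> \<phi> s x k)) s) x < \<epsilon> k x"
proof -
  have "0 < \<epsilon> k x"
    using assms(2) by (simp add: radii_def)
  then have "{n \<in> started \<phi> s. dist (ext (\<phi> n) s) x < \<epsilon> k x} \<noteq> {}"
    using skeleton_near[OF assms(1)] by blast
  from Inf_nat_def1[OF this]
  show "approx_index \<epsilon> \<phi> s x k \<in> started \<phi> s"
    "dist (ext (\<phi> (approx_index \<epsilon> \<phi> s x k)) s) x < \<epsilon> k x"
    by (simp_all add: approx_index_def)
qed

text \<open>The clause bounding the indices is what makes \<open>\<theta>\<close> follow the skeleton paths themselves.\<close>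

lemma Theta_tendsto:
  fixes \<phi> :: "nat \<Rightarrow> 'a :: heine_borel cpath"
  assumes l: "limit_selector l" and \<epsilon>: "radii \<epsilon>" and \<phi>: "skeleton \<phi>"
  obtains n where "\<And>k. n k \<in> started \<phi> s" "(\<lambda>k. ext (\<phi> (n k)) s) \<longlonglongrightarrow> x"
    "(\<lambda>k. tail (\<phi> (n k)) s) \<longlonglongrightarrow> Theta l \<epsilon> s x \<phi>"
    "\<And>k m. m \<in> started \<phi> s \<Longrightarrow> ext (\<phi> m) s = x \<Longrightarrow> n k \<le> m"
proof -
  let ?i = "approx_index \<epsilon> \<phi> s x"
  let ?f = "\<lambda>k. tail (\<phi> (?i k)) s"
  \<comment> \<open>The radii are non-increasing, so the ball of radius
    \<open>\<epsilon> 0 x\<close> contains all approximating values at time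
    \<open>s\<close>.\<close>
  let ?L = "{s} \<times> cball x (\<epsilon> 0 x)"
  let ?P = "{tail (\<phi> n) s |n s. n \<in> started \<phi> s \<and> (s, ext (\<phi> n) s) \<in> ?L}"
  have \<epsilon>x: "0 < \<epsilon> k x" "decseq (\<lambda>k. \<epsilon> k x)" "(\<lambda>k. \<epsilon> k x) \<longlonglongrightarrow> 0" for k
    using \<epsilon> by (auto simp: radii_def)
  have "ext (\<phi> (?i k)) s \<in> cball x (\<epsilon> 0 x)" for k
    using approx_index_near(2)[OF \<phi> \<epsilon>, of s x k] decseqD[OF \<epsilon>x(2), of 0 k]
    by (simp add: dist_commute)
  then have "range ?f \<subseteq> ?P"
    using approx_index_near(1)[OF \<phi> \<epsilon>, of s x] by blast
  then have "closure (range ?f) \<subseteq> closure ?P"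
    by (rule closure_mono)
  moreover have "compact (closure ?P)"
    by (intro skeleton_compact[OF \<phi>] compact_Times compact_cball) simp
  ultimately have "compact (closure (range ?f))"
    using compact_Int_closed[of "closure ?P" "closure (range ?f)"] by (simp add: Int_absorb1)
  then obtain r where r: "strict_mono r" and lim: "(?f \<circ> r) \<longlonglongrightarrow> l ?f"
    using l unfolding limit_selector_def by blast
  show thesis
  proof (rule that[of "\<lambda>k. ?i (r k)"])
    show "?i (r k) \<in> started \<phi> s" for k
      by (rule approx_index_near(1)[OF \<phi> \<epsilon>])
    have "(\<lambda>k. \<epsilon> (r k) x) \<longlonglongrightarrow> 0"
      using LIMSEQ_subseq_LIMSEQ[OF \<epsilon>x(3) r] by (simp add: o_def)
    then show "(\<lambda>k. ext (\<phi> (?i (r k))) s) \<longlonglongrightarrow> x"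
    proof (rule metric_tendsto_imp_tendsto)
      show "\<forall>\<^sub>F k in sequentially. dist (ext (\<phi> (?i (r k))) s) x \<le> dist (\<epsilon> (r k) x) 0"
        using approx_index_near(2)[OF \<phi> \<epsilon>, of s x] \<epsilon>x(1)
        by (intro always_eventually allI) (simp add: less_imp_le)
    qed
    show "(\<lambda>k. tail (\<phi> (?i (r k))) s) \<longlonglongrightarrow> Theta l \<epsilon> s x \<phi>"
      using lim by (simp add: o_def Theta_def)
    show "?i (r k) \<le> m" if "m \<in> started \<phi> s" "ext (\<phi> m) s = x" for k m
      unfolding approx_index_def using that \<epsilon>x(1) by (intro cInf_lower) auto
  qed
qed

lemma Theta_start:
  fixes \<phi> :: "nat \<Rightarrow> 'a :: heine_borel cpath"
  assumes "limit_selector l" "radii \<epsilon>" "skeleton \<phi>"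
  shows "ext (Theta l \<epsilon> s x \<phi>) s = x"
proof -
  obtain n where "(\<lambda>k. tail (\<phi> (n k)) s) \<longlonglongrightarrow> Theta l \<epsilon> s x \<phi>" "(\<lambda>k. ext (\<phi> (n k)) s) \<longlonglongrightarrow> x"
    using Theta_tendsto[OF assms] by metis
  with tendsto_ext[OF this(1), of s] show ?thesis
    by (simp add: ext_tail LIMSEQ_unique)
qed

text \<open>The indices used for the point \<open>\<phi>\<^sub>m(s)\<close> are at most \<open>m\<close>, so one of them is used infinitely often;
  by convergence that path passes through \<open>\<phi>\<^sub>m(s)\<close>, hence coalesces with \<open>\<phi>\<^sub>m\<close>.\<close>

lemma Theta_skeleton:
  fixes \<phi> :: "nat \<Rightarrow> 'a :: heine_borel cpath"
  assumes "limit_selector l" "radii \<epsilon>" and \<phi>: "skeleton \<phi>" and m: "m \<in> started \<phi> s" and "s \<le> t"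
  shows "ext (Theta l \<epsilon> s (ext (\<phi> m) s) \<phi>) t = ext (\<phi> m) t"
proof -
  let ?x = "ext (\<phi> m) s"
  obtain n where n: "\<And>k. n k \<in> started \<phi> s" "(\<lambda>k. ext (\<phi> (n k)) s) \<longlonglongrightarrow> ?x"
      "(\<lambda>k. tail (\<phi> (n k)) s) \<longlonglongrightarrow> Theta l \<epsilon> s ?x \<phi>" "\<And>k. n k \<le> m"
    using Theta_tendsto[OF assms(1-3)] m by metis
  have "finite (range n)"
    by (rule finite_subset[of _ "{..m}"]) (use n(4) in auto)
  then obtain c where "infinite {k. n k = c}"
    using pigeonhole_infinite[of UNIV n] by auto
  then obtain r :: "nat \<Rightarrow> nat" where r: "strict_mono r" and c: "\<And>k. n (r k) = c"
    using infinite_enumerate by blast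
  have "c \<in> started \<phi> s"
    using n(1) c by metis
  moreover have "ext (\<phi> c) s = ?x"
    using LIMSEQ_subseq_LIMSEQ[OF n(2) r] by (simp add: o_def c LIMSEQ_const_iff)
  ultimately have "ext (\<phi> c) t = ext (\<phi> m) t"
    using skeleton_coalesce[OF \<phi>] m \<open>s \<le> t\<close> by blast
  moreover have "ext (Theta l \<epsilon> s ?x \<phi>) t = ext (\<phi> c) t"
    using LIMSEQ_subseq_LIMSEQ[OF tendsto_ext[OF n(3), of t] r] \<open>s \<le> t\<close>
    by (simp add: o_def c ext_tail max_absorb2 LIMSEQ_const_iff)
  ultimately show ?thesis by simp
qed

section \<open>Limits of skeleton paths, and uniqueness off bifurcation points\<close>

text \<open>Convergence is asked only from \<open>s\<close> on and \<open>f\<close> may start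
  earlier, so a path selected at an earlier time also counts as a limit from each point it later
  visits.\<close>

definition limit_from :: "(nat \<Rightarrow> 'a :: metric_space cpath) \<Rightarrow> real \<Rightarrow> 'a \<Rightarrow> 'a cpath \<Rightarrow> bool"
  where "limit_from \<phi> s x f \<longleftrightarrow> (\<exists>n. (\<forall>k. n k \<in> started \<phi> s) \<and> (\<lambda>k. ext (\<phi> (n k)) s) \<longlonglongrightarrow> x \<and>
    (\<forall>t. uniform_limit {s..t} (\<lambda>k. ext (\<phi> (n k))) (ext f) sequentially))"

lemma restrict_ext_in_cfunspace:
  "restrict (ext f) {s..t} \<in> mspace (cfunspace (top_of_set {s..t}) euclidean_metric)"
proof -
  have "continuous_on {s..t} (restrict (ext f) {s..t})"
    using continuous_ext by (rule continuous_on_eq) simp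
  then show ?thesis
    by (subst compactin_mspace_cfunspace) (simp_all add: compactin_subtopology)
qed

text \<open>Far along the sequence, a path is both within \<open>e\<close> of \<open>x\<close> at
  time \<open>s\<close> and uniformly close to \<open>f\<close> on the interval, hence witnesses
  membership in the closure.\<close>

lemma limit_from_in_limit_paths:
  assumes "limit_from \<phi> s x f"
  shows "restrict (ext f) {s..t} \<in> limit_paths \<phi> s t x"
  unfolding limit_paths_def
proof (rule INT_I)
  fix e :: real assume "e \<in> {0<..}"
  then have e: "0 < e" by simp
  obtain n where n: "\<And>k. n k \<in> started \<phi> s" "(\<lambda>k. ext (\<phi> (n k)) s) \<longlonglongrightarrow> x"
      "uniform_limit {s..t} (\<lambda>k. ext (\<phi> (n k))) (ext f) sequentially"
    using assms unfolding limit_from_def by blast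
  let ?C = "cfunspace (top_of_set {s..t}) (euclidean_metric :: 'a metric)"
  let ?S = "{restrict (ext (\<phi> n)) {s..t} |n. n \<in> started \<phi> s \<and> ext (\<phi> n) s \<in> ball x e}"
  \<comment> \<open>The closure is tested with closed balls, matching the non-strict bound available
    for the supremum distance.\<close>
  have "\<exists>y\<in>?S. y \<in> Metric_space.mcball (mspace ?C) (mdist ?C) (restrict (ext f) {s..t}) r"
    if r: "0 < r" for r
  proof -
    have "\<forall>\<^sub>F k in sequentially. dist (ext (\<phi> (n k)) s) x < e \<and>
        (\<forall>u\<in>{s..t}. dist (ext (\<phi> (n k)) u) (ext f u) < r)"
      using tendstoD[OF n(2) e] uniform_limitD[OF n(3) r] by (rule eventually_conj)
    from eventually_happens'[OF sequentially_bot this]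
    obtain k where k: "dist (ext (\<phi> (n k)) s) x < e"
        "\<And>u. u \<in> {s..t} \<Longrightarrow> dist (ext (\<phi> (n k)) u) (ext f u) < r"
      by blast
    have "mdist ?C (restrict (ext f) {s..t}) (restrict (ext (\<phi> (n k))) {s..t}) \<le> r"
      using r k(2) by (intro mdist_cfunspace_le) (auto simp: dist_commute less_imp_le)
    then have "restrict (ext (\<phi> (n k))) {s..t} \<in>
        Metric_space.mcball (mspace ?C) (mdist ?C) (restrict (ext f) {s..t}) r"
      unfolding Metric_space.in_mcball[OF Metric_space_mspace_mdist]
      by (intro conjI restrict_ext_in_cfunspace)
    moreover have "restrict (ext (\<phi> (n k))) {s..t} \<in> ?S"
      using k(1) n(1) by (auto simp: dist_commute)
    ultimately show ?thesis
      by (rule bexI[where x = "restrict (ext (\<phi> (n k))) {s..t}"])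
  qed
  then show "restrict (ext f) {s..t} \<in> nearby_paths \<phi> s t x e"
    unfolding nearby_paths_def mtopology_of_def
      Metric_space.metric_closure_of_alt[OF Metric_space_mspace_mdist]
    by (intro CollectI conjI allI impI restrict_ext_in_cfunspace)
qed

text \<open>Off the bifurcation points the split time exceeds \<open>s\<close>; any \<open>t\<close>
  strictly between leaves at most one limit path on \<open>{s..t}\<close>. The same \<open>t\<close>
  works for all pairs of limits.\<close>

lemma limit_from_unique:
  assumes "(s, x) \<notin> bifurcation_points \<phi>"
  obtains t where "s < t"
    "\<And>f g u. limit_from \<phi> s x f \<Longrightarrow> limit_from \<phi> s x g \<Longrightarrow> u \<in> {s..t} \<Longrightarrow> ext f u = ext g u"
proof -
  have "ereal s \<le> split_time \<phi> s x"
    unfolding split_time_def by (intro Inf_greatest) auto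
  moreover have "ereal s \<noteq> split_time \<phi> s x"
    using assms by (auto simp: bifurcation_points_def)
  ultimately have "ereal s < split_time \<phi> s x"
    by (rule order.not_eq_order_implies_strict[rotated])
  then obtain t where t: "s < t" "ereal t < split_time \<phi> s x"
    using ereal_dense2[of "ereal s" "split_time \<phi> s x"] by auto
  let ?K = "limit_paths \<phi> s t x"
  have "\<not> 2 \<le> num_limit_paths \<phi> s t x"
  proof
    assume "2 \<le> num_limit_paths \<phi> s t x"
    then have "split_time \<phi> s x \<le> ereal t"
      unfolding split_time_def using t(1) by (intro Inf_lower) blast
    with t(2) show False by simp
  qed
  then have K: "finite ?K" "card ?K < 2"
    unfolding num_limit_paths_def by (auto split: if_splits simp: numeral_eq_enat)
  show thesis
  proof (rule that[OF t(1)])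
    fix f g u
    assume f: "limit_from \<phi> s x f" and g: "limit_from \<phi> s x g" and u: "u \<in> {s..t}"
    have "card ?K \<le> Suc 0"
      using K(2) by simp
    then have "restrict (ext f) {s..t} = restrict (ext g) {s..t}"
      using limit_from_in_limit_paths[OF f, of t] limit_from_in_limit_paths[OF g, of t] K(1)
      by (simp add: card_le_Suc0_iff_eq)
    from fun_cong[OF this, of u] show "ext f u = ext g u"
      using u by simp
  qed
qed

section \<open>The flow property\<close>

text \<open>Continuous induction: at the infimum \<open>c\<close> of the times of disagreement the
  paths still agree, by closedness, and \<open>step\<close> carries agreement beyond
  \<open>c\<close>.\<close>

lemma agree_continuation:
  fixes f g :: "real \<Rightarrow> 'a :: t2_space"
  assumes cont: "continuous_on UNIV f" "continuous_on UNIV g" and start: "f t = g t"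
    and step: "\<And>v. t \<le> v \<Longrightarrow> v < u \<Longrightarrow> f v = g v \<Longrightarrow> \<exists>w>v. \<forall>r\<in>{v..w}. f r = g r"
    and r: "r \<in> {t..u}"
  shows "f r = g r"
proof (rule ccontr)
  assume ne: "f r \<noteq> g r"
  define A where "A = {v \<in> {t..u}. f v \<noteq> g v}"
  define c where "c = Inf A"
  have A: "r \<in> A" "bdd_below A"
    using r ne by (auto simp: A_def intro: bdd_belowI[of _ t])
  have c: "t \<le> c" "c \<le> r"
    unfolding c_def using A by (auto simp: A_def intro: cInf_greatest cInf_lower)
  have before: "f v = g v" if "t \<le> v" "v < c" for v
    using cInf_lower[OF _ A(2), of v] that c r unfolding c_def[symmetric] by (auto simp: A_def)
  have "f c = g c"
  proof (cases "t = c")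
    case False
    have "{t..<c} \<subseteq> {v. f v = g v}"
      using before by auto
    then have "closure {t..<c} \<subseteq> {v. f v = g v}"
      by (rule closure_minimal) (intro closed_Collect_eq cont)
    then show ?thesis
      using False c(1) by auto
  qed (use start in simp)
  moreover from this ne c(2) have "c < r"
    by (cases "c = r") auto
  ultimately obtain w where w: "c < w" "\<forall>v\<in>{c..w}. f v = g v"
    using step[OF c(1)] r by auto
  have "w \<le> v" if "v \<in> A" for v
    using that w(2) cInf_lower[OF that A(2)] unfolding c_def[symmetric]
    by (auto simp: A_def not_le[symmetric])
  then have "w \<le> c"
    unfolding c_def using A(1) by (intro cInf_greatest) auto
  with w(1) show False by simp
qed

lemma started_mono: "s \<le> t \<Longrightarrow> n \<in> started \<phi> s \<Longrightarrow> n \<in> started \<phi> t"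
  by (simp add: started_def)

text \<open>The skeleton paths converging to the selected path from \<open>s\<close> also converge
  to it from \<open>v\<close>, and their values at \<open>v\<close> tend to its value there.\<close>

lemma Theta_limit_from:
  fixes \<phi> :: "nat \<Rightarrow> 'a :: heine_borel cpath"
  assumes "limit_selector l" "radii \<epsilon>" "skeleton \<phi>" "s \<le> v"
  shows "limit_from \<phi> v (ext (Theta l \<epsilon> s x \<phi>) v) (Theta l \<epsilon> s x \<phi>)"
proof -
  let ?f = "Theta l \<epsilon> s x \<phi>"
  obtain n where n: "\<And>k. n k \<in> started \<phi> s" "(\<lambda>k. tail (\<phi> (n k)) s) \<longlonglongrightarrow> ?f"
    using Theta_tendsto[OF assms(1-3)] by metis
  have ext: "ext (tail (\<phi> (n k)) s) u = ext (\<phi> (n k)) u" if "v \<le> u" for k u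
    using that \<open>s \<le> v\<close> by (simp add: ext_tail max_absorb2)
  have "(\<lambda>k. ext (\<phi> (n k)) v) \<longlonglongrightarrow> ext ?f v"
    using tendsto_ext[OF n(2), of v] by (simp add: ext)
  moreover have "uniform_limit {v..t} (\<lambda>k. ext (\<phi> (n k))) (ext ?f) sequentially" for t
    using uniform_limit_ext[OF n(2), of v t]
    by (rule uniform_limit_cong'[THEN iffD1, rotated -1]) (simp_all add: ext)
  ultimately show ?thesis
    unfolding limit_from_def using n(1) started_mono[OF \<open>s \<le> v\<close>] by (intro exI[of _ n]) auto
qed

text \<open>Wherever the restarted and the original path agree, both are limits from one
  non-bifurcation point, hence agree a little longer. The endpoint \<open>u\<close> itself may
  bifurcate, since agreement reaches it by continuity.\<close>

lemma Theta_flow: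
  fixes \<phi> :: "nat \<Rightarrow> 'a :: heine_borel cpath"
  assumes hyps: "limit_selector l" "radii \<epsilon>" "skeleton \<phi>" and "s \<le> t"
    and avoid: "\<And>v. t \<le> v \<Longrightarrow> v < u \<Longrightarrow>
      (v, ext (Theta l \<epsilon> s x \<phi>) v) \<notin> bifurcation_points \<phi>"
    and r: "r \<in> {t..u}"
  shows "ext (Theta l \<epsilon> t (ext (Theta l \<epsilon> s x \<phi>) t) \<phi>) r = ext (Theta l \<epsilon> s x \<phi>) r"
proof (rule agree_continuation[OF continuous_ext continuous_ext _ _ r])
  show "ext (Theta l \<epsilon> t (ext (Theta l \<epsilon> s x \<phi>) t) \<phi>) t = ext (Theta l \<epsilon> s x \<phi>) t"
    by (rule Theta_start[OF hyps])
  fix v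
  assume v: "t \<le> v" "v < u"
    and eq: "ext (Theta l \<epsilon> t (ext (Theta l \<epsilon> s x \<phi>) t) \<phi>) v = ext (Theta l \<epsilon> s x \<phi>) v"
  show "\<exists>w>v. \<forall>r\<in>{v..w}.
      ext (Theta l \<epsilon> t (ext (Theta l \<epsilon> s x \<phi>) t) \<phi>) r = ext (Theta l \<epsilon> s x \<phi>) r"
    using limit_from_unique[OF avoid[OF v]] Theta_limit_from[OF hyps v(1), of "ext (Theta l \<epsilon> s x \<phi>) t"]
      Theta_limit_from[OF hyps order_trans[OF \<open>s \<le> t\<close> v(1)], of x] unfolding eq by metis
qed

context hitting_scheme
begin

lemma sigma_Suc_0:
  "sigma \<theta> F s x (Suc 0) = Inf {ereal t |t. s < t \<and> (t, \<theta> s t x) \<in> F}"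
  unfolding sigma.simps(2) by simp

end

section \<open>First hits and the flow of \<open>\<theta>\<close> before them\<close>

locale skeleton_flow =
  fixes l :: "(nat \<Rightarrow> 'a :: heine_borel cpath) \<Rightarrow> 'a cpath"
    and \<epsilon> :: "nat \<Rightarrow> 'a \<Rightarrow> real"
    and \<phi> :: "nat \<Rightarrow> 'a cpath"
    and \<theta> :: "real \<Rightarrow> real \<Rightarrow> 'a \<Rightarrow> 'a"
    and F :: "(real \<times> 'a) set"
  assumes selector: "limit_selector l"
    and radii: "radii \<epsilon>"
    and skeleton: "skeleton \<phi>"
    and theta: "\<theta> = (\<lambda>s t x. ext (Theta l \<epsilon> s x \<phi>) t)"
    and F_closed: "closed F"
    and F_bifurcation: "bifurcation_points \<phi> \<subseteq> F"
    and a: "\<And>s x. stop_index \<theta> F s x < \<infinity>"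
    and b: "\<And>s x t. stop_index \<theta> F s x = 0 \<Longrightarrow> s < t \<Longrightarrow>
              \<exists>n\<in>started \<phi> t. tail (Theta l \<epsilon> s x \<phi>) t = tail (\<phi> n) t"
begin

sublocale hitting_scheme \<theta> F
  by unfold_locales (simp add: theta Theta_start[OF selector radii skeleton])

lemma continuous_theta: "continuous_on S (\<lambda>t. \<theta> s t x)"
  unfolding theta by (rule continuous_ext)

lemma theta_skeleton: "n \<in> started \<phi> s \<Longrightarrow> s \<le> t \<Longrightarrow> \<theta> s t (ext (\<phi> n) s) = ext (\<phi> n) t"
  unfolding theta by (rule Theta_skeleton[OF selector radii skeleton])

text \<open>The set of times at which the path lies in \<open>F\<close> is closed, so the infimum of
  hits after \<open>s\<close> is itself a hit.\<close>

lemma first_hit_in_F: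
  assumes "sigma \<theta> F s x (Suc 0) = ereal r"
  shows "(r, \<theta> s r x) \<in> F"
proof (rule ccontr)
  assume "(r, \<theta> s r x) \<notin> F"
  then have r: "r \<in> - ((\<lambda>t. (t, \<theta> s t x)) -` F)"
    by simp
  have "closed ((\<lambda>t. (t, \<theta> s t x)) -` F)"
    by (intro closed_vimage F_closed continuous_on_Pair continuous_theta continuous_on_id)
  then have "open (- ((\<lambda>t. (t, \<theta> s t x)) -` F))"
    by (rule open_Compl)
  from openE[OF this r] obtain e where e: "0 < e" "ball r e \<subseteq> - ((\<lambda>t. (t, \<theta> s t x)) -` F)" .
  have "sigma \<theta> F s x (Suc 0) < ereal (r + e)"
    using assms e(1) by simp
  then obtain t where t: "s < t" "(t, \<theta> s t x) \<in> F" "t < r + e"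
    unfolding sigma_Suc_0 Inf_less_iff by auto
  moreover have "r \<le> t"
    using sigma_first_hit_le[OF t(1,2)] assms by simp
  ultimately have "t \<in> ball r e"
    by (auto simp: dist_real_def)
  with e(2) t(2) show False by auto
qed

text \<open>Strictly between \<open>s\<close> and the first hit the path avoids \<open>F\<close>,
  hence all bifurcation points. At \<open>s\<close> itself it may lie in \<open>F\<close>, which is
  why \<open>s < t\<close> is strict.\<close>

lemma theta_flow:
  assumes "s < t" "t \<le> u" "ereal u \<le> sigma \<theta> F s x (Suc 0)"
  shows "\<theta> t u (\<theta> s t x) = \<theta> s u x"
proof -
  have "(v, \<theta> s v x) \<notin> bifurcation_points \<phi>" if "t \<le> v" "v < u" for v
  proof
    assume "(v, \<theta> s v x) \<in> bifurcation_points \<phi>"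
    then have "sigma \<theta> F s x (Suc 0) \<le> ereal v"
      using F_bifurcation that \<open>s < t\<close> by (intro sigma_first_hit_le) auto
    with assms(3) have "ereal u \<le> ereal v" by (rule order_trans)
    with that show False by simp
  qed
  then show ?thesis
    using Theta_flow[OF selector radii skeleton, of s t u x u] assms(1,2) by (simp add: theta)
qed

text \<open>The original path and the one restarted at \<open>t\<close> agree up to the first hit,
  so they meet \<open>F\<close> at the same time.\<close>

lemma first_hit_flow:
  assumes t: "s < t" "ereal t < sigma \<theta> F s x (Suc 0)"
  shows "sigma \<theta> F t (\<theta> s t x) (Suc 0) = sigma \<theta> F s x (Suc 0)"
proof (rule antisym)
  show "sigma \<theta> F s x (Suc 0) \<le> sigma \<theta> F t (\<theta> s t x) (Suc 0)"
    unfolding sigma_Suc_0[of t]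
  proof (rule Inf_greatest, clarify)
    fix u assume u: "t < u" "(u, \<theta> t u (\<theta> s t x)) \<in> F"
    show "sigma \<theta> F s x (Suc 0) \<le> ereal u"
    proof (cases "ereal u \<le> sigma \<theta> F s x (Suc 0)")
      case True
      with u t show ?thesis
        using theta_flow[OF t(1), of u x] by (intro sigma_first_hit_le) auto
    qed simp
  qed
  show "sigma \<theta> F t (\<theta> s t x) (Suc 0) \<le> sigma \<theta> F s x (Suc 0)"
  proof (cases rule: sigma_cases[of s x "Suc 0"])
    case (real r)
    with t have "t < r" by simp
    then have "(r, \<theta> t r (\<theta> s t x)) \<in> F"
      using first_hit_in_F[OF real(1)] theta_flow[OF t(1), of r x] real(1) by simp
    then show ?thesis
      unfolding real(1) using \<open>t < r\<close> by (intro sigma_first_hit_le)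
  qed simp
qed

section \<open>Continuity, skeleton preservation and flow property of \<open>psi\<close>\<close>

lemmas psi_induct = first_hit_induct[OF a, case_names stop infinite hit]

lemma psi_infinite:
  "sigma \<theta> F s x (Suc 0) = \<infinity> \<Longrightarrow> s \<le> t \<Longrightarrow> psi \<theta> F s t x = \<theta> s t x"
  by (rule psi_before) simp_all

text \<open>Includes the endpoint \<open>r\<close>: there \<open>psi\<close> has just been restarted
  at \<open>\<theta> s r x\<close> and takes that value.\<close>

lemma psi_until_first_hit:
  assumes r: "sigma \<theta> F s x (Suc 0) = ereal r"
    and after: "\<And>t. r \<le> t \<Longrightarrow> psi \<theta> F s t x = psi \<theta> F r t (\<theta> s r x)"
    and t: "s \<le> t" "t \<le> r"
  shows "psi \<theta> F s t x = \<theta> s t x"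
proof (cases "t = r")
  case True
  then show ?thesis using after[of r] by (simp add: psi_start)
next
  case False
  then show ?thesis using t r by (intro psi_before) simp_all
qed

lemma continuous_psi: "continuous_on {s..} (\<lambda>t. psi \<theta> F s t x)"
proof (induction s x rule: psi_induct)
  case (stop s x)
  then show ?case
    using psi_stop by (intro continuous_on_eq[OF continuous_theta[of _ s x]]) simp
next
  case (infinite s x)
  then show ?case
    using psi_infinite by (intro continuous_on_eq[OF continuous_theta[of _ s x]]) simp
next
  case (hit s x r)
  have "continuous_on {s..r} (\<lambda>t. psi \<theta> F s t x)"
    using psi_until_first_hit[OF hit(1,3)]
    by (intro continuous_on_eq[OF continuous_theta[of _ s x]]) simp
  moreover have "continuous_on {r..} (\<lambda>t. psi \<theta> F s t x)"
    using hit(3) by (intro continuous_on_eq[OF hit(4)]) simp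
  ultimately have "continuous_on ({s..r} \<union> {r..}) (\<lambda>t. psi \<theta> F s t x)"
    by (intro continuous_on_closed_Un) auto
  moreover have "{s..r} \<union> {r..} = {s..}"
    using hit(2) by auto
  ultimately show ?case by simp
qed

text \<open>Since \<open>\<theta>\<close> follows \<open>\<phi> n\<close> up to the first hit, the
  restart point is again on \<open>\<phi> n\<close>, and the induction hypothesis takes
  over.\<close>

lemma psi_skeleton:
  assumes "n \<in> started \<phi> s" "x = ext (\<phi> n) s" "s \<le> t"
  shows "psi \<theta> F s t x = ext (\<phi> n) t"
  using assms
proof (induction s x rule: psi_induct)
  case (stop s x)
  then show ?case by (simp add: psi_stop theta_skeleton)
next
  case (infinite s x)
  then show ?case by (simp add: psi_infinite theta_skeleton)
next
  case (hit s x r)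
  show ?case
  proof (cases "t \<le> r")
    case True
    with hit show ?thesis
      using psi_until_first_hit[OF hit(1,3), of t] by (simp add: theta_skeleton)
  next
    case False
    with hit show ?thesis
      using started_mono[of s r n \<phi>] by (simp add: theta_skeleton)
  qed
qed

lemma psi_flow:
  assumes "s \<le> t" "t \<le> u"
  shows "psi \<theta> F t u (psi \<theta> F s t x) = psi \<theta> F s u x"
  using assms(1)
proof (induction s x rule: psi_induct)
  case (stop s x)
  show ?case
  proof (cases "s = t")
    case False
    with stop have "s < t" by simp
    \<comment> \<open>By (b) the path runs along \<open>\<phi> n\<close> from \<open>t\<close> on,
      and \<open>psi\<close> restarted at \<open>t\<close> preserves that path.\<close>
    obtain n where n: "n \<in> started \<phi> t" "tail (Theta l \<epsilon> s x \<phi>) t = tail (\<phi> n) t"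
      using b[OF stop_index_eq_0[OF stop(1)] \<open>s < t\<close>] by blast
    have eq: "\<theta> s v x = ext (\<phi> n) v" if "t \<le> v" for v
      using arg_cong[OF n(2), of "\<lambda>f. ext f v"] that by (simp add: theta ext_tail max_absorb2)
    show ?thesis
      using psi_skeleton[OF n(1) refl assms(2)] stop assms(2) by (simp add: psi_stop eq)
  qed (simp add: psi_start)
next
  case (infinite s x)
  show ?case
  proof (cases "s = t")
    case False
    with infinite have t: "s < t" by simp
    have "sigma \<theta> F t (\<theta> s t x) (Suc 0) = \<infinity>"
      using first_hit_flow[OF t, of x] infinite(1) by simp
    then show ?thesis
      using theta_flow[OF t assms(2), of x] infinite assms(2) by (simp add: psi_infinite)
  qed (simp add: psi_start)
next
  case (hit s x r)
  show ?case
  proof (cases "s = t")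
    case True
    then show ?thesis by (simp add: psi_start)
  next
    case False
    with hit have t: "s < t" by simp
    show ?thesis
    proof (cases "r \<le> t")
      case True
      then show ?thesis
        using hit(3)[of t] hit(3)[of u] hit(4) assms(2) by simp
    next
      \<comment> \<open>Here \<open>s < t < r\<close>: the path restarted at \<open>t\<close> has
        the same first hit \<open>r\<close> and the same point there, so both sides restart
        identically after \<open>r\<close>.\<close>
      case False
      let ?y = "\<theta> s t x"
      have y: "psi \<theta> F s t x = ?y"
        using False hit(1) t by (intro psi_before) simp_all
      have r: "sigma \<theta> F t ?y (Suc 0) = ereal r"
        using first_hit_flow[OF t, of x] hit(1) False by simp
      obtain k where k: "sigma \<theta> F t ?y k = sigma \<theta> F t ?y (Suc k)"
        using stop_index_stationary[OF a] by blast
      have after: "psi \<theta> F t v ?y = psi \<theta> F r v (\<theta> t r ?y)" if "r \<le> v" for v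
        using psi_after[OF r that k] .
      have flow: "\<theta> t v ?y = \<theta> s v x" if "t \<le> v" "v \<le> r" for v
        using theta_flow[OF t that(1), of x] that(2) hit(1) by simp
      show ?thesis
      proof (cases "u \<le> r")
        case True
        then show ?thesis
          using psi_until_first_hit[OF r after, of u] psi_until_first_hit[OF hit(1,3), of u]
            flow[of u] assms(2) t y by simp
      next
        case u: False
        then show ?thesis
          using after[of u] hit(3)[of u] flow[of r] False y by simp
      qed
    qed
  qed
qed

end

theorem theorem2p8:
  fixes l :: "(nat \<Rightarrow> 'a :: heine_borel cpath) \<Rightarrow> 'a cpath"
    and \<epsilon> :: "nat \<Rightarrow> 'a \<Rightarrow> real"
    and \<phi> :: "nat \<Rightarrow> 'a cpath"
    and \<theta> :: "real \<Rightarrow> real \<Rightarrow> 'a \<Rightarrow> 'a"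
    and F :: "(real \<times> 'a) set"
  assumes selector: "limit_selector l"
    and radii: "radii \<epsilon>"
    and skeleton: "skeleton \<phi>"
    and theta: "\<theta> = (\<lambda>s t x. ext (Theta l \<epsilon> s x \<phi>) t)"
    and F_closed: "closed F"
    and F_bifurcation: "bifurcation_points \<phi> \<subseteq> F"
    and a: "\<And>s x. stop_index \<theta> F s x < \<infinity>"
    and b: "\<And>s x t. stop_index \<theta> F s x = 0 \<Longrightarrow> s < t \<Longrightarrow>
              \<exists>n\<in>started \<phi> t. tail (Theta l \<epsilon> s x \<phi>) t = tail (\<phi> n) t"
  shows "(\<forall>s x. continuous_on {s..} (\<lambda>t. psi \<theta> F s t x) \<and> psi \<theta> F s s x = x) \<and>
         (\<forall>s t. s \<le> t \<longrightarrow> (\<forall>n\<in>started \<phi> s. psi \<theta> F s t (ext (\<phi> n) s) = ext (\<phi> n) t)) \<and>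
         (\<forall>s t u. s \<le> t \<longrightarrow> t \<le> u \<longrightarrow> psi \<theta> F t u \<circ> psi \<theta> F s t = psi \<theta> F s u)"
proof -
  interpret skeleton_flow l \<epsilon> \<phi> \<theta> F
    using assms by unfold_locales
  show ?thesis
    using continuous_psi psi_start psi_skeleton[OF _ refl] psi_flow by (auto simp: fun_eq_iff)
qed

end
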